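(* Let $\mathcal{P} \subseteq \mathbb{R}_+^I$ be a convex set and let $\mathcal{R}$ be a set of revenue functions $R : \mathcal{P} \to \mathbb{R}$ such that every $R \in \mathcal{R}$ is a concave function of $\mathbf{p}$. Then the robust price optimization problem is randomization-proof, that is, $Z^*_{\mathrm{RR}} = Z^*_{\mathrm{DR}}$.
   Context: $I$ is a positive integer (the number of products), $\mathbb{R}_+$ is the set of nonnegative reals, $\mathcal{P}\subseteq\mathbb{R}_+^I$ is the set of feasible price vectors, and $\mathcal{R}$ is an arbitrary (uncertainty) set of real-valued revenue functions on $\mathcal{P}$. The deterministic robust price optimization problem has optimal value $$Z^*_{\mathrm{DR}} = \max_{\mathbf{p}\in\mathcal{P}} \min_{R\in\mathcal{R}} R(\mathbf{p}).$$ The randomized robust price optimization problem has optimal value $$Z^*_{\mathrm{RR}} = \max_{F\in\mathcal{F}} \min_{R\in\mathcal{R}} \int_{\mathcal{P}} R(\mathbf{p})\,dF(\mathbf{p}),$$ where $\mathcal{F}$ is the set of all probability distributions supported on $\mathcal{P}$. The robust price optimization problem is called randomization-proof if $Z^*_{\mathrm{RR}} = Z^*_{\mathrm{DR}}$.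
   Formalization: The randomized problem ranges only over distributions on P with finite mean price vector (automatic if P is bounded); for all distributions the claim fails, e.g. P=[0,∞), R_k(p)=min(p/k,c_k), F of infinite mean. Max and min are read as supremum and infimum. *)

theory Defs
  imports "HOL-Probability.Probability"
begin

text \<open>
  Throughout, \<open>P\<close> is the set of feasible price vectors and \<open>\<R>\<close> the uncertainty set. Revenue
  functions are total, but only their values on \<open>P\<close> enter below. The optimal values are taken in
  \<open>ereal\<close>, with max and min read as supremum and infimum, so no attainment is presupposed.
\<close>

definition Z_DR :: "(real ^ 'i) set \<Rightarrow> ((real ^ 'i) \<Rightarrow> real) set \<Rightarrow> ereal" where
  "Z_DR P \<R> = (SUP p\<in>P. INF R\<in>\<R>. ereal (R p))"

text \<open>The trace sigma-algebra is used because a convex set need not be Borel.\<close>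

definition prob_distributions :: "(real ^ 'i) set \<Rightarrow> (real ^ 'i) measure set" where
  "prob_distributions P = {F. prob_space F \<and> sets F = sets (restrict_space borel P)}"

text \<open>
  The randomized problem ranges over distributions whose expected price vector exists. Without
  this, the concave functions \<open>R\<^sub>k p = min (p / k) c\<^sub>k\<close> on \<open>[0, \<infinity>)\<close> have pointwise infimum 0, while
  for a distribution of infinite mean the constants \<open>c\<^sub>k\<close> can be chosen such that every \<open>R\<^sub>k\<close> has
  expectation at least 1. For bounded \<open>P\<close> the requirement is vacuous.
\<close>

definition price_distributions :: "(real ^ 'i) set \<Rightarrow> (real ^ 'i) measure set" where
  "price_distributions P = {F \<in> prob_distributions P. integrable F (\<lambda>p. p)}"

lemma price_distributions_bounded:
  assumes "bounded P"
  shows "price_distributions P = prob_distributions P"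
proof -
  have "integrable F (\<lambda>p. p)" if "F \<in> prob_distributions P" for F
  proof -
    interpret prob_space F using that by (simp add: prob_distributions_def)
    have F: "sets F = sets (restrict_space borel P)"
      using that by (simp add: prob_distributions_def)
    have "space F = P"
      using sets_eq_imp_space_eq[OF F] by (simp add: space_restrict_space)
    moreover obtain B where "\<And>p. p \<in> P \<Longrightarrow> norm p \<le> B"
      using assms by (auto simp: bounded_iff)
    moreover have "(\<lambda>p. p) \<in> borel_measurable F"
      unfolding measurable_cong_sets[OF F refl] by (intro measurable_restrict_space1) simp
    ultimately show ?thesis
      by (intro integrable_const_bound[of _ B]) auto
  qed
  then show ?thesis by (auto simp: price_distributions_def)
qed

text \<open>
  The integral with values in the extended reals: unlike the Bochner integral, which is 0 for a
  non-integrable function, it is \<open>-\<infinity>\<close> if only the negative part has infinite integral. (A concave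
  function on \<open>P\<close> has an affine upper bound there, so under a distribution of finite mean its positive
  part always has finite integral.) Concave functions can be non-measurable on the boundary of \<open>P\<close>;
  for those the two nonnegative integrals are lower integrals.
\<close>

definition ext_integral :: "'a measure \<Rightarrow> ('a \<Rightarrow> real) \<Rightarrow> ereal" where
  "ext_integral M f =
     enn2ereal (\<integral>\<^sup>+ x. ennreal (f x) \<partial>M) - enn2ereal (\<integral>\<^sup>+ x. ennreal (- f x) \<partial>M)"

lemma ext_integral_eq_integral:
  assumes "integrable M f"
  shows "ext_integral M f = ereal (\<integral>x. f x \<partial>M)"
proof -
  obtain r q where rq: "0 \<le> r" "0 \<le> q"
    "(\<integral>\<^sup>+ x. ennreal (f x) \<partial>M) = ennreal r" "(\<integral>\<^sup>+ x. ennreal (- f x) \<partial>M) = ennreal q"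
    "(\<integral>x. f x \<partial>M) = r - q"
    using integrableE[OF assms] by metis
  then show ?thesis by (simp add: ext_integral_def enn2ereal_ennreal)
qed

definition Z_RR :: "(real ^ 'i) set \<Rightarrow> ((real ^ 'i) \<Rightarrow> real) set \<Rightarrow> ereal" where
  "Z_RR P \<R> = (SUP F\<in>price_distributions P. INF R\<in>\<R>. ext_integral F R)"

definition randomization_proof :: "(real ^ 'i) set \<Rightarrow> ((real ^ 'i) \<Rightarrow> real) set \<Rightarrow> bool" where
  "randomization_proof P \<R> \<longleftrightarrow> Z_RR P \<R> = Z_DR P \<R>"

end

theory Submission
  imports Defs
begin

text \<open>
  Let \<open>m\<close> be the mean of a price distribution. Among the faces of \<open>P\<close> of full mass, one of least
  dimension has \<open>m\<close> in its relative interior: otherwise a supporting hyperplane at \<open>m\<close> carries all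
  the mass and cuts out a smaller such face. On that face a concave function has an affine majorant
  that is exact at \<open>m\<close>, which gives Jensen's inequality without any measurability or openness
  assumption. So the deterministic price \<open>m\<close> does at least as well as the distribution; conversely
  deterministic prices are point masses.
\<close>

lemma mem_rel_interior_epigraph:
  fixes f :: "'a::euclidean_space \<Rightarrow> real"
  assumes "convex_on S f"
  shows "(x, r) \<in> rel_interior (epigraph S f) \<longleftrightarrow> x \<in> rel_interior S \<and> f x < r"
proof -
  define fibre where "fibre x = {r. (x, r) \<in> epigraph S f}" for x
  have fibre: "fibre x = (if x \<in> S then {f x..} else {})" for x
    by (auto simp: fibre_def mem_epigraph)
  then have "{x. fibre x \<noteq> {}} = S" by auto
  moreover have "convex (epigraph S f)" using assms by (rule convex_epigraphI)
  ultimately have "(x, r) \<in> rel_interior (epigraph S f) \<longleftrightarrow>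
      x \<in> rel_interior S \<and> r \<in> rel_interior (fibre x)"
    using rel_interior_projection[of "epigraph S f" fibre x r] by (simp add: fibre_def[abs_def])
  also have "\<dots> \<longleftrightarrow> x \<in> rel_interior S \<and> f x < r"
    using rel_interior_subset[of S] by (auto simp: fibre rel_interior_nonempty_interior)
  finally show ?thesis .
qed

lemma convex_on_rel_interior_subgradient:
  fixes f :: "'a::euclidean_space \<Rightarrow> real"
  assumes f: "convex_on S f" and m: "m \<in> rel_interior S"
  obtains v where "\<And>x. x \<in> S \<Longrightarrow> f m + v \<bullet> (x - m) \<le> f x"
proof -
  have "(m, f m) \<in> epigraph S f" using m rel_interior_subset by (auto simp: mem_epigraph)
  moreover have "(m, f m) \<notin> rel_interior (epigraph S f)"
    by (simp add: mem_rel_interior_epigraph[OF f])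
  ultimately obtain normal where
    supports: "\<And>z. z \<in> epigraph S f \<Longrightarrow> normal \<bullet> (m, f m) \<le> normal \<bullet> z" and
    strictly: "\<And>z. z \<in> rel_interior (epigraph S f) \<Longrightarrow> normal \<bullet> (m, f m) < normal \<bullet> z"
    using supporting_hyperplane_rel_boundary f convex_epigraph by metis
  obtain u t where normal: "normal = (u, t)" by (cases normal)
  have "(m, f m + 1) \<in> rel_interior (epigraph S f)"
    using m by (simp add: mem_rel_interior_epigraph[OF f])
  from strictly[OF this] have t: "t > 0" by (simp add: normal algebra_simps)
  show thesis
  proof
    fix x assume "x \<in> S"
    then have "u \<bullet> m + t * f m \<le> u \<bullet> x + t * f x"
      using supports[of "(x, f x)"] by (simp add: normal mem_epigraph)
    then show "f m + (- (1 / t) *\<^sub>R u) \<bullet> (x - m) \<le> f x"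
      using t by (simp add: field_simps inner_diff_right)
  qed
qed

context prob_space
begin

lemma expectation_in_closure:
  fixes X :: "'a \<Rightarrow> 'b::euclidean_space"
  assumes X: "integrable M X" "AE x in M. X x \<in> S" and "convex S"
  shows "expectation X \<in> closure S"
proof (rule ccontr)
  assume "expectation X \<notin> closure S"
  then obtain a b where
    below: "a \<bullet> expectation X < b" and above: "\<And>y. y \<in> closure S \<Longrightarrow> b < a \<bullet> y"
    using separating_hyperplane_closed_point[of "closure S" "expectation X"] \<open>convex S\<close>
    by auto
  have "AE x in M. b \<le> a \<bullet> X x"
    using X(2) by eventually_elim (use above closure_subset in \<open>force intro: less_imp_le\<close>)
  then have "b \<le> expectation (\<lambda>x. a \<bullet> X x)" using X(1) by (intro integral_ge_const) simp_all
  with below show False using X(1) by simp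
qed

lemma AE_proper_face:
  fixes X :: "'a \<Rightarrow> 'b::euclidean_space"
  assumes X: "integrable M X" "AE x in M. X x \<in> S" and "convex S"
    and not_interior: "expectation X \<notin> rel_interior S"
  obtains F where "F face_of S" "F \<noteq> S" "AE x in M. X x \<in> F"
proof -
  let ?m = "expectation X"
  have "?m \<in> closure S" using X \<open>convex S\<close> by (rule expectation_in_closure)
  then obtain a where
    supports: "\<And>y. y \<in> closure S \<Longrightarrow> a \<bullet> ?m \<le> a \<bullet> y" and
    strictly: "\<And>y. y \<in> rel_interior S \<Longrightarrow> a \<bullet> ?m < a \<bullet> y"
    using supporting_hyperplane_relative_frontier[OF \<open>convex S\<close> _ not_interior] by metis
  have S_supports: "a \<bullet> ?m \<le> a \<bullet> y" if "y \<in> S" for y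
    using that supports closure_subset by blast
  let ?F = "S \<inter> {y. a \<bullet> y = a \<bullet> ?m}"
  show thesis
  proof
    show "?F face_of S"
      using \<open>convex S\<close> S_supports by (rule face_of_Int_supporting_hyperplane_ge)
    have "S \<noteq> {}" using X(2) by (auto simp: AE_False)
    then obtain y where "y \<in> rel_interior S"
      using rel_interior_eq_empty[OF \<open>convex S\<close>] by blast
    with strictly rel_interior_subset show "?F \<noteq> S" by force
    have "AE x in M. a \<bullet> ?m \<le> a \<bullet> X x" using X(2) by eventually_elim (rule S_supports)
    then have "AE x in M. a \<bullet> ?m = a \<bullet> X x"
      using X(1) by (intro integral_eq_mono_AE_eq_AE) (simp_all add: prob_space)
    with X(2) show "AE x in M. X x \<in> ?F" by eventually_elim simp
  qed
qed

lemma AE_face_expectation_in_rel_interior: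
  fixes X :: "'a \<Rightarrow> 'b::euclidean_space"
  assumes X: "integrable M X" "AE x in M. X x \<in> S" and "convex S"
  obtains F where "F face_of S" "AE x in M. X x \<in> F" "expectation X \<in> rel_interior F"
proof -
  let ?full = "\<lambda>F. F face_of S \<and> (AE x in M. X x \<in> F)"
  have "?full S" using X \<open>convex S\<close> face_of_refl by blast
  then obtain F where F: "F face_of S" "AE x in M. X x \<in> F"
    and minimal: "\<And>G. ?full G \<Longrightarrow> nat (aff_dim F + 1) \<le> nat (aff_dim G + 1)"
    using ex_has_least_nat[of ?full S "\<lambda>F. nat (aff_dim F + 1)"] by blast
  have "convex F" using F(1) by (rule face_of_imp_convex)
  have "expectation X \<in> rel_interior F"
  proof (rule ccontr)
    assume "expectation X \<notin> rel_interior F"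
    with X(1) F(2) \<open>convex F\<close> obtain G where
      G: "G face_of F" "G \<noteq> F" "AE x in M. X x \<in> G"
      by (rule AE_proper_face)
    have "aff_dim G < aff_dim F" using \<open>convex F\<close> G(1,2) by (rule face_of_aff_dim_lt)
    moreover have "?full G" using G(1,3) F(1) face_of_trans by blast
    ultimately show False using minimal[of G] aff_dim_geq[of G] by simp
  qed
  with F show thesis by (rule that)
qed

lemma expectation_in_convex:
  fixes X :: "'a \<Rightarrow> 'b::euclidean_space"
  assumes "integrable M X" "AE x in M. X x \<in> S" "convex S"
  shows "expectation X \<in> S"
proof -
  obtain F where "F face_of S" "expectation X \<in> rel_interior F"
    using AE_face_expectation_in_rel_interior[OF assms] by metis
  then show ?thesis using face_of_imp_subset rel_interior_subset[of F] by blast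
qed

end

lemma ext_integral_mono_AE:
  assumes "AE x in M. f x \<le> g x"
  shows "ext_integral M f \<le> ext_integral M g"
proof -
  have "(\<integral>\<^sup>+ x. ennreal (f x) \<partial>M) \<le> (\<integral>\<^sup>+ x. ennreal (g x) \<partial>M)"
    by (rule nn_integral_mono_AE, use assms in eventually_elim) (simp add: ennreal_leI)
  moreover have "(\<integral>\<^sup>+ x. ennreal (- g x) \<partial>M) \<le> (\<integral>\<^sup>+ x. ennreal (- f x) \<partial>M)"
    by (rule nn_integral_mono_AE, use assms in eventually_elim) (simp add: ennreal_leI)
  ultimately show ?thesis
    unfolding ext_integral_def by (intro ereal_minus_mono) (simp_all add: less_eq_ennreal.rep_eq)
qed

lemma ext_integral_cong_AE:
  assumes "AE x in M. f x = g x"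
  shows "ext_integral M f = ext_integral M g"
  using assms by (intro antisym ext_integral_mono_AE) auto

lemma (in prob_space) ext_integral_jensen_concave:
  fixes X :: "'a \<Rightarrow> 'b::euclidean_space"
  assumes X: "integrable M X" "AE x in M. X x \<in> S" and f: "concave_on S f"
  shows "ext_integral M (\<lambda>x. f (X x)) \<le> ereal (f (expectation X))"
proof -
  let ?m = "expectation X"
  obtain F where F: "F face_of S" "AE x in M. X x \<in> F" "?m \<in> rel_interior F"
    using AE_face_expectation_in_rel_interior X concave_on_imp_convex[OF f] by blast
  have "convex_on F (\<lambda>x. - f x)"
    using f face_of_imp_subset[OF F(1)] face_of_imp_convex[OF F(1)]
    by (auto simp: concave_on_def intro: convex_on_subset)
  then obtain v where v: "\<And>x. x \<in> F \<Longrightarrow> - f ?m + v \<bullet> (x - ?m) \<le> - f x"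
    using convex_on_rel_interior_subgradient F(3) by metis
  let ?majorant = "\<lambda>x. f ?m - v \<bullet> (X x - ?m)"
  have integrable: "integrable M ?majorant" using X(1) by simp
  have "AE x in M. f (X x) \<le> ?majorant x" using F(2) by eventually_elim (use v in fastforce)
  then have "ext_integral M (\<lambda>x. f (X x)) \<le> ext_integral M ?majorant"
    by (rule ext_integral_mono_AE)
  also have "\<dots> = ereal (expectation ?majorant)"
    using integrable by (rule ext_integral_eq_integral)
  also have "expectation ?majorant = f ?m" using X(1) by (simp add: prob_space)
  finally show ?thesis .
qed

lemma integrable_return:
  fixes g :: "'a \<Rightarrow> 'b::{banach, second_countable_topology}"
  assumes "x \<in> space M" "g \<in> borel_measurable M"
  shows "integrable (return M x) g"
  using assms by (intro integrableI_bounded) (simp_all add: nn_integral_return)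

lemma AE_return_eq:
  assumes "{x} \<in> sets M"
  shows "AE y in return M x. y = x"
proof -
  have "x \<in> space M" using sets.sets_into_space[OF assms] by simp
  moreover from this have "{y \<in> space M. y = x} = {x}" by auto
  ultimately show ?thesis using assms by (simp add: AE_return pred_def)
qed

lemma ext_integral_return:
  assumes "{x} \<in> sets M"
  shows "ext_integral (return M x) f = ereal (f x)"
proof -
  interpret prob_space "return M x"
    using sets.sets_into_space[OF assms] by (intro prob_space_return) simp
  have "ext_integral (return M x) f = ext_integral (return M x) (\<lambda>_. f x)"
    using AE_return_eq[OF assms] by (intro ext_integral_cong_AE) auto
  also have "\<dots> = ereal (f x)" using prob_space by (simp add: ext_integral_eq_integral)
  finally show ?thesis .
qed

lemma singleton_in_sets_restrict_borel:
  fixes x :: "'a::t1_space"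
  assumes "x \<in> S"
  shows "{x} \<in> sets (restrict_space borel S)"
  using assms by (auto simp: sets_restrict_space intro!: image_eqI[of _ _ "{x}"])

lemma return_in_price_distributions:
  assumes "p \<in> P"
  shows "return (restrict_space borel P) p \<in> price_distributions P"
proof -
  have "p \<in> space (restrict_space borel P)" using assms by (simp add: space_restrict_space)
  moreover have "(\<lambda>p. p) \<in> borel_measurable (restrict_space borel P)"
    by (simp add: measurable_restrict_space1)
  ultimately show ?thesis
    by (simp add: price_distributions_def prob_distributions_def prob_space_return
        integrable_return)
qed

lemma price_distributionsD:
  assumes "F \<in> price_distributions P"
  shows "prob_space F" "integrable F (\<lambda>p. p)" "AE p in F. p \<in> P"
proof -
  have "sets F = sets (restrict_space borel P)"
    using assms by (simp add: price_distributions_def prob_distributions_def)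
  then have "space F = P" by (auto dest: sets_eq_imp_space_eq simp: space_restrict_space)
  then show "AE p in F. p \<in> P" by (intro AE_I2) simp
qed (use assms in \<open>simp_all add: price_distributions_def prob_distributions_def\<close>)

lemma Z_DR_le_Z_RR: "Z_DR P \<R> \<le> Z_RR P \<R>"
  unfolding Z_DR_def Z_RR_def
proof (rule SUP_mono)
  fix p assume "p \<in> P"
  let ?F = "return (restrict_space borel P) p"
  have "(INF R\<in>\<R>. ereal (R p)) = (INF R\<in>\<R>. ext_integral ?F R)"
    using singleton_in_sets_restrict_borel[OF \<open>p \<in> P\<close>] by (simp add: ext_integral_return)
  then show "\<exists>F\<in>price_distributions P. (INF R\<in>\<R>. ereal (R p)) \<le> (INF R\<in>\<R>. ext_integral F R)"
    using return_in_price_distributions[OF \<open>p \<in> P\<close>] by auto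
qed

lemma Z_RR_le_Z_DR:
  assumes "convex P" and concave: "\<And>R. R \<in> \<R> \<Longrightarrow> concave_on P R"
  shows "Z_RR P \<R> \<le> Z_DR P \<R>"
  unfolding Z_DR_def Z_RR_def
proof (rule SUP_mono)
  fix F assume "F \<in> price_distributions P"
  note F = price_distributionsD[OF this]
  interpret prob_space F by (rule F(1))
  let ?m = "expectation (\<lambda>p. p)"
  have "?m \<in> P" using F(2,3) \<open>convex P\<close> by (rule expectation_in_convex)
  moreover have "(INF R\<in>\<R>. ext_integral F R) \<le> (INF R\<in>\<R>. ereal (R ?m))"
    using ext_integral_jensen_concave[OF F(2,3) concave] by (intro INF_mono) auto
  ultimately show "\<exists>p\<in>P. (INF R\<in>\<R>. ext_integral F R) \<le> (INF R\<in>\<R>. ereal (R p))" by blast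
qed

theorem theorem1:
  fixes P :: "(real ^ 'i::finite) set" and \<R> :: "((real ^ 'i) \<Rightarrow> real) set"
  assumes "P \<subseteq> {p. \<forall>i. 0 \<le> p $ i}"
    and "convex P"
    and "\<And>R. R \<in> \<R> \<Longrightarrow> concave_on P R"
  shows "randomization_proof P \<R>"
  unfolding randomization_proof_def
proof (rule antisym)
  show "Z_RR P \<R> \<le> Z_DR P \<R>" using assms(2,3) by (rule Z_RR_le_Z_DR)
  show "Z_DR P \<R> \<le> Z_RR P \<R>" by (rule Z_DR_le_Z_RR)
qed

end
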